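(* For any $k$-uniform hypergraph $\mathcal{F}$ and any integers $r\ge k$ and $n$, $$\mathrm{ex}_k(n,\mathcal{K}_r^{(k)},\mathcal{F})\le \mathrm{ex}_r(n,\text{Berge-}\mathcal{F})\le \mathrm{ex}_k(n,\mathcal{K}_r^{(k)},\mathcal{F})+\mathrm{ex}_k(n,\mathcal{F}).$$
   Context: A hypergraph $\mathcal{B}$ is a Berge copy of $\mathcal{F}$ (Berge-$\mathcal{F}$) if, up to isomorphism, $V(\mathcal{F})\subseteq V(\mathcal{B})$ and there is a bijection $f:E(\mathcal{F})\to E(\mathcal{B})$ with $e\subseteq f(e)$ for all $e\in E(\mathcal{F})$. $\mathrm{ex}_r(n,\text{Berge-}\mathcal{F})$ is the maximum number of hyperedges in an $n$-vertex $r$-uniform hypergraph having no subhypergraph that is a Berge copy of $\mathcal{F}$. A hypergraph is $\mathcal{F}$-free if it has no subhypergraph isomorphic to $\mathcal{F}$. $\mathrm{ex}_k(n,\mathcal{F})$ is the maximum number of hyperedges in an $\mathcal{F}$-free $k$-uniform hypergraph on $n$ vertices. $\mathcal{K}_r^{(k)}$ is the complete $k$-uniform hypergraph on $r$ vertices, and $\mathrm{ex}_k(n,\mathcal{K}_r^{(k)},\mathcal{F})$ is the maximum number of copies of $\mathcal{K}_r^{(k)}$ (subhypergraphs isomorphic to it) in an $\mathcal{F}$-free $k$-uniform hypergraph on $n$ vertices. *)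

theory Defs
  imports Main
begin

type_synonym 'a hypergraph = "'a set \<times> 'a set set"

abbreviation verts :: "'a hypergraph \<Rightarrow> 'a set" where
  "verts H \<equiv> fst H"

abbreviation hedges :: "'a hypergraph \<Rightarrow> 'a set set" where
  "hedges H \<equiv> snd H"

definition hypergraph :: "'a hypergraph \<Rightarrow> bool" where
  "hypergraph H \<longleftrightarrow> finite (verts H) \<and> (\<forall>e\<in>hedges H. e \<subseteq> verts H)"

definition uniform :: "nat \<Rightarrow> 'a hypergraph \<Rightarrow> bool" where
  "uniform k H \<longleftrightarrow> hypergraph H \<and> (\<forall>e\<in>hedges H. card e = k)"

definition isomorphic :: "'a hypergraph \<Rightarrow> 'b hypergraph \<Rightarrow> bool" where
  "isomorphic G H \<longleftrightarrow>
     (\<exists>\<phi>. bij_betw \<phi> (verts G) (verts H) \<and> (\<lambda>e. \<phi> ` e) ` hedges G = hedges H)"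

definition subhypergraph :: "'a hypergraph \<Rightarrow> 'a hypergraph \<Rightarrow> bool" where
  "subhypergraph S H \<longleftrightarrow> hypergraph S \<and> verts S \<subseteq> verts H \<and> hedges S \<subseteq> hedges H"

definition copies :: "'a hypergraph \<Rightarrow> 'b hypergraph \<Rightarrow> 'b hypergraph set" where
  "copies F H = {S. subhypergraph S H \<and> isomorphic F S}"

definition is_free :: "'a hypergraph \<Rightarrow> 'b hypergraph \<Rightarrow> bool" where
  "is_free F H \<longleftrightarrow> copies F H = {}"

text \<open>The phrase ``up to isomorphism'' in the definition of a Berge copy is rendered by an
  isomorphic image \<open>F'\<close> of \<open>F\<close> that lives on vertices of \<open>B\<close>.\<close>

definition berge_copy :: "'a hypergraph \<Rightarrow> 'b hypergraph \<Rightarrow> bool" where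
  "berge_copy F B \<longleftrightarrow>
     (\<exists>F'. isomorphic F F' \<and> verts F' \<subseteq> verts B \<and>
        (\<exists>f. bij_betw f (hedges F') (hedges B) \<and> (\<forall>e\<in>hedges F'. e \<subseteq> f e)))"

definition berge_free :: "'a hypergraph \<Rightarrow> 'b hypergraph \<Rightarrow> bool" where
  "berge_free F H \<longleftrightarrow> \<not> (\<exists>B. subhypergraph B H \<and> berge_copy F B)"

definition complete_hypergraph :: "nat \<Rightarrow> nat \<Rightarrow> nat hypergraph" where
  "complete_hypergraph k r = ({..<r}, {e. e \<subseteq> {..<r} \<and> card e = k})"

text \<open>Every finite hypergraph is isomorphic to one whose vertices are natural numbers, so the
  maxima below range over host hypergraphs of type \<^typ>\<open>nat hypergraph\<close>. All the sets
  involved are finite (see the lemmas at the end), so \<^const>\<open>Sup\<close> is their maximum; if no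
  host hypergraph qualifies, which happens only for an edgeless \<open>F\<close> with at most \<open>n\<close> vertices,
  the value is \<open>0\<close>.\<close>

definition ex_edges :: "nat \<Rightarrow> nat \<Rightarrow> 'a hypergraph \<Rightarrow> nat" where
  "ex_edges k n F = Sup {card (hedges H) | H :: nat hypergraph.
     uniform k H \<and> card (verts H) = n \<and> is_free F H}"

definition ex_berge :: "nat \<Rightarrow> nat \<Rightarrow> 'a hypergraph \<Rightarrow> nat" where
  "ex_berge r n F = Sup {card (hedges H) | H :: nat hypergraph.
     uniform r H \<and> card (verts H) = n \<and> berge_free F H}"

definition ex_count :: "nat \<Rightarrow> nat \<Rightarrow> 'a hypergraph \<Rightarrow> 'b hypergraph \<Rightarrow> nat" where
  "ex_count k n K F = Sup {card (copies K H) | H :: nat hypergraph.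
     uniform k H \<and> card (verts H) = n \<and> is_free F H}"

lemma card_hedges_le:
  assumes "hypergraph H"
  shows "card (hedges H) \<le> 2 ^ card (verts H)"
proof -
  have "hedges H \<subseteq> Pow (verts H)" "finite (verts H)"
    using assms by (auto simp: hypergraph_def)
  then show ?thesis by (metis card_Pow card_mono finite_Pow_iff)
qed

lemma card_copies_le:
  assumes "hypergraph H"
  shows "card (copies K H) \<le> 2 ^ card (verts H) * 2 ^ (2 ^ card (verts H))"
proof -
  have fin: "finite (verts H)" using assms by (simp add: hypergraph_def)
  have "copies K H \<subseteq> Pow (verts H) \<times> Pow (Pow (verts H))"
    by (force simp: copies_def subhypergraph_def hypergraph_def)
  then have "card (copies K H) \<le> card (Pow (verts H) \<times> Pow (Pow (verts H)))"
    using fin by (intro card_mono) auto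
  then show ?thesis using fin by (simp add: card_cartesian_product card_Pow)
qed

lemma finite_ex_set:
  "finite {card (hedges H) | H :: nat hypergraph.
     uniform k H \<and> card (verts H) = n \<and> P H}"
  by (rule finite_subset[of _ "{..2 ^ n}"]) (auto simp: uniform_def dest: card_hedges_le)

lemma finite_ex_count_set:
  "finite {card (copies K H) | H :: nat hypergraph.
     uniform k H \<and> card (verts H) = n \<and> P H}"
  by (rule finite_subset[of _ "{..2 ^ n * 2 ^ (2 ^ n)}"])
     (auto simp: uniform_def dest: card_copies_le)

end

theory Submission
  imports Defs
begin

text \<open>
  A copy of the complete \<open>k\<close>-uniform hypergraph on \<open>r\<close> vertices in a \<open>k\<close>-uniform hypergraph \<open>G\<close>
  is determined by its vertex set, so counting copies amounts to counting \<open>r\<close>-cliques, the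
  \<open>r\<close>-sets of vertices all of whose \<open>k\<close>-subsets are edges of \<open>G\<close> (\<open>card_copies_complete\<close>).

  Lower bound: let \<open>G\<close> be \<open>F\<close>-free, and let the hyperedges of \<open>H\<close> be the \<open>r\<close>-cliques of \<open>G\<close>.  In a
  Berge copy of \<open>F\<close> inside \<open>H\<close>, each edge of the underlying copy of \<open>F\<close> is a \<open>k\<close>-subset of a
  clique, hence an edge of \<open>G\<close>; the underlying copy would therefore lie in \<open>G\<close>.  So \<open>H\<close> is
  Berge-\<open>F\<close>-free (\<open>berge_free_cliques\<close>).

  Upper bound: let \<open>H\<close> be \<open>r\<close>-uniform and Berge-\<open>F\<close>-free.  Match hyperedges of \<open>H\<close> injectively to
  \<open>k\<close>-sets that they contain, in an inclusion-maximal way (\<open>maximal_matching\<close>), and let \<open>G\<close> consist of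
  the \<open>k\<close>-sets used.  Each of these is contained in its own hyperedge, so a copy of \<open>F\<close> in \<open>G\<close> would
  yield a Berge copy of \<open>F\<close> in \<open>H\<close>; thus \<open>G\<close> is \<open>F\<close>-free (\<open>is_free_matched\<close>).  The matched hyperedges
  are as many as the edges of \<open>G\<close>.  By maximality, a hyperedge left unmatched has all its
  \<open>k\<close>-subsets in \<open>G\<close>, that is, it is an \<open>r\<close>-clique of \<open>G\<close>.  The two terms of the bound count
  the unmatched and the matched hyperedges.
\<close>

definition ksubsets :: "nat \<Rightarrow> 'a set \<Rightarrow> 'a set set" where
  "ksubsets k U = {e. e \<subseteq> U \<and> card e = k}"

definition cliques :: "nat \<Rightarrow> nat \<Rightarrow> 'a hypergraph \<Rightarrow> 'a set set" where
  "cliques k r G = {U. U \<subseteq> verts G \<and> card U = r \<and> ksubsets k U \<subseteq> hedges G}"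

lemma image_ksubsets:
  assumes "bij_betw \<phi> A B"
  shows "(\<lambda>e. \<phi> ` e) ` ksubsets k A = ksubsets k B"
proof (intro equalityI subsetI)
  fix x assume "x \<in> (\<lambda>e. \<phi> ` e) ` ksubsets k A"
  then show "x \<in> ksubsets k B"
    using assms by (auto simp: ksubsets_def bij_betw_def card_image inj_on_subset)
next
  fix x assume x: "x \<in> ksubsets k B"
  then obtain y where "y \<subseteq> A" "x = \<phi> ` y"
    using assms unfolding ksubsets_def bij_betw_def by (metis (mono_tags) mem_Collect_eq subset_imageE)
  then show "x \<in> (\<lambda>e. \<phi> ` e) ` ksubsets k A"
    using assms x by (auto simp: ksubsets_def bij_betw_def card_image inj_on_subset)
qed

lemma isomorphic_complete_iff:
  assumes "finite (verts S)"
  shows "isomorphic (complete_hypergraph k r) S \<longleftrightarrow>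
    card (verts S) = r \<and> hedges S = ksubsets k (verts S)"
proof -
  have K: "complete_hypergraph k r = ({..<r}, ksubsets k {..<r})"
    by (simp add: complete_hypergraph_def ksubsets_def)
  have "isomorphic (complete_hypergraph k r) S \<longleftrightarrow>
      (\<exists>\<phi>. bij_betw \<phi> {..<r} (verts S)) \<and> ksubsets k (verts S) = hedges S"
    unfolding isomorphic_def K fst_conv snd_conv using image_ksubsets by metis
  moreover have "(\<exists>\<phi>. bij_betw \<phi> {..<r} (verts S)) \<longleftrightarrow> card (verts S) = r"
    using assms bij_betw_iff_card[of "{..<r}" "verts S"] by auto
  ultimately show ?thesis by auto
qed

lemma card_copies_complete:
  assumes "hypergraph G"
  shows "card (copies (complete_hypergraph k r) G) = card (cliques k r G)"
proof -
  have fin: "finite (verts G)" using assms by (simp add: hypergraph_def)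
  have "copies (complete_hypergraph k r) G = (\<lambda>U. (U, ksubsets k U)) ` cliques k r G"
  proof (intro equalityI subsetI)
    fix S assume "S \<in> copies (complete_hypergraph k r) G"
    then have sub: "subhypergraph S G" and iso: "isomorphic (complete_hypergraph k r) S"
      by (auto simp: copies_def)
    then have "finite (verts S)" by (simp add: subhypergraph_def hypergraph_def)
    with iso have S: "card (verts S) = r" "hedges S = ksubsets k (verts S)"
      by (simp_all add: isomorphic_complete_iff)
    then have "verts S \<in> cliques k r G"
      using sub by (simp add: cliques_def subhypergraph_def)
    moreover have "S = (verts S, ksubsets k (verts S))"
      using S by (simp add: prod_eq_iff)
    ultimately show "S \<in> (\<lambda>U. (U, ksubsets k U)) ` cliques k r G"
      by (rule rev_image_eqI)
  next
    fix S assume "S \<in> (\<lambda>U. (U, ksubsets k U)) ` cliques k r G"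
    then obtain U where U: "U \<in> cliques k r G" and S: "S = (U, ksubsets k U)" by blast
    then have "finite U" using fin by (auto simp: cliques_def intro: finite_subset)
    then show "S \<in> copies (complete_hypergraph k r) G"
      using U by (auto simp: copies_def S isomorphic_complete_iff subhypergraph_def
          hypergraph_def cliques_def ksubsets_def)
  qed
  then show ?thesis by (simp add: card_image inj_on_def)
qed

lemma uniform_isomorphic:
  assumes "uniform k F" and "isomorphic F F'"
  shows "uniform k F'"
proof -
  obtain \<phi> where bij: "bij_betw \<phi> (verts F) (verts F')"
    and im: "(\<lambda>e. \<phi> ` e) ` hedges F = hedges F'"
    using assms(2) unfolding isomorphic_def by blast
  have "hedges F \<subseteq> ksubsets k (verts F)"
    using assms(1) by (auto simp: uniform_def hypergraph_def ksubsets_def)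
  then have "hedges F' \<subseteq> ksubsets k (verts F')"
    unfolding im[symmetric] image_ksubsets[OF bij, symmetric] by (rule image_mono)
  moreover have "finite (verts F')"
    using assms(1) bij_betw_finite[OF bij] by (simp add: uniform_def hypergraph_def)
  ultimately show ?thesis
    by (auto simp: uniform_def hypergraph_def ksubsets_def)
qed

lemma berge_free_cliques:
  assumes "uniform k F" and free: "is_free F G"
  shows "berge_free F (verts G, cliques k r G)"
proof -
  have False if B: "subhypergraph B (verts G, cliques k r G)" and copy: "berge_copy F B" for B
  proof -
    obtain F' f where iso: "isomorphic F F'" and V: "verts F' \<subseteq> verts B"
      and f: "bij_betw f (hedges F') (hedges B)" and sub: "\<forall>e\<in>hedges F'. e \<subseteq> f e"
      using copy by (auto simp: berge_copy_def)
    have F': "uniform k F'" using assms(1) iso by (rule uniform_isomorphic)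
    have "e \<in> hedges G" if e: "e \<in> hedges F'" for e
    proof -
      have "f e \<in> cliques k r G"
        using bij_betwE[OF f] e B by (auto simp: subhypergraph_def)
      moreover have "e \<in> ksubsets k (f e)"
        using F' sub e by (simp add: uniform_def ksubsets_def)
      ultimately show ?thesis by (auto simp: cliques_def)
    qed
    then have "subhypergraph F' G"
      using F' V B by (auto simp: subhypergraph_def uniform_def)
    with iso free show False unfolding is_free_def copies_def by blast
  qed
  then show ?thesis by (auto simp: berge_free_def)
qed

text \<open>Greedy construction: run through \<open>A\<close> and match each element to a partner that is still
  available, if there is one.\<close>

lemma maximal_matching:
  assumes "finite A"
  obtains M g where "M \<subseteq> A" and "inj_on g M" and "\<And>a. a \<in> M \<Longrightarrow> R a (g a)"
    and "\<And>a s. a \<in> A - M \<Longrightarrow> R a s \<Longrightarrow> s \<in> g ` M"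
proof -
  have "\<exists>M g. M \<subseteq> A \<and> inj_on g M \<and> (\<forall>a\<in>M. R a (g a)) \<and>
    (\<forall>a\<in>A - M. \<forall>s. R a s \<longrightarrow> s \<in> g ` M)"
    using assms
  proof induction
    case empty
    then show ?case by auto
  next
    case (insert a A)
    then obtain M g where M: "M \<subseteq> A" "inj_on g M" "\<forall>b\<in>M. R b (g b)"
      "\<forall>b\<in>A - M. \<forall>s. R b s \<longrightarrow> s \<in> g ` M" by blast
    have a: "a \<notin> M" using M insert.hyps by blast
    show ?case
    proof (cases "\<exists>s. R a s \<and> s \<notin> g ` M")
      case True
      then obtain s where s: "R a s" "s \<notin> g ` M" by blast
      let ?g = "g(a := s)"
      have im: "?g ` M = g ` M" using a by auto
      have "inj_on ?g M"
        using M(2) a by (metis fun_upd_other inj_on_cong)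
      then have "inj_on ?g (insert a M)"
        using s(2) a im by simp
      moreover have "\<forall>b\<in>insert a M. R b (?g b)"
        using M(3) s(1) a by simp
      moreover have "\<forall>b\<in>insert a A - insert a M. \<forall>t. R b t \<longrightarrow> t \<in> ?g ` insert a M"
        using M(4) im by blast
      moreover have "insert a M \<subseteq> insert a A" using M(1) by blast
      ultimately show ?thesis by blast
    next
      case False
      then have "\<forall>b\<in>insert a A - M. \<forall>s. R b s \<longrightarrow> s \<in> g ` M"
        using M(4) by blast
      moreover have "M \<subseteq> insert a A" using M(1) by blast
      ultimately show ?thesis using M(2,3) by blast
    qed
  qed
  then show thesis using that by blast
qed

lemma is_free_matched:
  assumes hyp: "hypergraph H" and free: "berge_free F H"
    and M: "M \<subseteq> hedges H" and inj: "inj_on g M" and sub: "\<And>e. e \<in> M \<Longrightarrow> g e \<subseteq> e"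
  shows "is_free F (verts H, g ` M)"
proof -
  have False if S: "subhypergraph S (verts H, g ` M)" and iso: "isomorphic F S" for S
  proof -
    let ?f = "inv_into M g"
    let ?B = "(verts H, ?f ` hedges S)"
    have SM: "hedges S \<subseteq> g ` M" using S by (simp add: subhypergraph_def)
    have f: "?f e \<in> M" "e \<subseteq> ?f e" if "e \<in> hedges S" for e
    proof -
      have e: "e \<in> g ` M" using that SM by blast
      show "?f e \<in> M" using e by (rule inv_into_into)
      then show "e \<subseteq> ?f e" using sub[of "?f e"] e by (simp add: f_inv_into_f)
    qed
    have "bij_betw ?f (hedges S) (hedges ?B)"
      using SM by (simp add: bij_betw_def inj_on_inv_into)
    moreover have "verts S \<subseteq> verts ?B" using S by (simp add: subhypergraph_def)
    ultimately have "berge_copy F ?B"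
      using iso f(2) unfolding berge_copy_def by blast
    moreover have "subhypergraph ?B H"
      using f(1) M hyp by (auto simp: subhypergraph_def hypergraph_def)
    ultimately show False using free by (auto simp: berge_free_def)
  qed
  then show ?thesis by (auto simp: is_free_def copies_def)
qed

text \<open>The empty set is included, as \<open>Sup {} = 0\<close> on the naturals; this covers the case that no
  host hypergraph qualifies.\<close>

lemma Sup_nat_le:
  fixes X :: "nat set"
  assumes "finite X" and "\<And>x. x \<in> X \<Longrightarrow> x \<le> b"
  shows "Sup X \<le> b"
  using assms by (cases "X = {}") (auto simp: Sup_nat_def)

lemma cliques_count_le_ex_count:
  fixes G :: "nat hypergraph"
  assumes "uniform k G" and "is_free F G"
  shows "card (cliques k r G) \<le> ex_count k (card (verts G)) (complete_hypergraph k r) F"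
proof -
  have "card (cliques k r G) = card (copies (complete_hypergraph k r) G)"
    using assms(1) by (simp add: card_copies_complete uniform_def)
  then show ?thesis
    unfolding ex_count_def using assms
    by (intro le_cSup_finite finite_ex_count_set) blast
qed

lemma ex_count_le_ex_berge:
  assumes "uniform k F"
  shows "ex_count k n (complete_hypergraph k r) F \<le> ex_berge r n F"
  unfolding ex_count_def
proof (rule Sup_nat_le[OF finite_ex_count_set], clarify)
  fix V :: "nat set" and E :: "nat set set"
  let ?G = "(V, E)" and ?H = "(V, cliques k r (V, E))"
  assume G: "uniform k ?G" "is_free F ?G" and n: "n = card (verts ?G)"
  have "uniform r ?H"
    using G(1) by (auto simp: uniform_def hypergraph_def cliques_def)
  moreover have "berge_free F ?H"
    using berge_free_cliques[OF assms G(2)] by simp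
  ultimately have "card (hedges ?H) \<le> ex_berge r (card (verts ?H)) F"
    unfolding ex_berge_def by (intro le_cSup_finite finite_ex_set) blast
  then show "card (copies (complete_hypergraph k r) ?G) \<le> ex_berge r (card (verts ?G)) F"
    using G(1) by (simp add: card_copies_complete uniform_def)
qed

lemma ex_berge_le_ex_count_plus_ex_edges:
  "ex_berge r n F \<le> ex_count k n (complete_hypergraph k r) F + ex_edges k n F"
  unfolding ex_berge_def
proof (rule Sup_nat_le[OF finite_ex_set], clarify)
  fix V :: "nat set" and E :: "nat set set"
  let ?H = "(V, E)"
  assume H: "uniform r ?H" "berge_free F ?H" and n: "n = card (verts ?H)"
  have hyp: "hypergraph ?H" using H(1) by (simp add: uniform_def)
  then have fin: "finite V" "finite E"
    by (auto simp: hypergraph_def intro: finite_subset[of E "Pow V"])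
  obtain M g where M: "M \<subseteq> E" and inj: "inj_on g M"
    and g: "\<And>e. e \<in> M \<Longrightarrow> g e \<in> ksubsets k e"
    and max: "\<And>e s. e \<in> E - M \<Longrightarrow> s \<in> ksubsets k e \<Longrightarrow> s \<in> g ` M"
    using maximal_matching[OF fin(2), of "\<lambda>e s. s \<in> ksubsets k e"] by metis
  let ?G = "(V, g ` M)"
  have G: "uniform k ?G"
    using hyp M g unfolding uniform_def hypergraph_def ksubsets_def by fastforce
  have free: "is_free F ?G"
    using is_free_matched[OF hyp H(2) _ inj] M g by (simp add: ksubsets_def)
  have "card (hedges ?G) \<le> ex_edges k (card (verts ?G)) F"
    unfolding ex_edges_def using G free by (intro le_cSup_finite finite_ex_set) blast
  then have matched: "card M \<le> ex_edges k (card V) F"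
    using inj by (simp add: card_image)
  have "E - M \<subseteq> cliques k r ?G"
    using H(1) max by (auto simp: cliques_def uniform_def hypergraph_def)
  moreover have "finite (cliques k r ?G)"
    using fin by (intro finite_subset[of "cliques k r ?G" "Pow V"]) (auto simp: cliques_def)
  ultimately have "card (E - M) \<le> card (cliques k r ?G)"
    by (intro card_mono)
  also have "\<dots> \<le> ex_count k (card V) (complete_hypergraph k r) F"
    using cliques_count_le_ex_count[OF G free] by simp
  finally have "card (E - M) \<le> ex_count k (card V) (complete_hypergraph k r) F" .
  moreover have "card E = card (E - M) + card M"
    using M fin(2) by (metis add.commute card_Diff_subset card_mono finite_subset le_add_diff_inverse)
  ultimately show "card (hedges ?H)
      \<le> ex_count k (card (verts ?H)) (complete_hypergraph k r) F + ex_edges k (card (verts ?H)) F"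
    using matched by simp
qed

theorem corollary19:
  fixes F :: "'a hypergraph" and k r n :: nat
  assumes "uniform k F" and "k \<le> r"
  shows "ex_count k n (complete_hypergraph k r) F \<le> ex_berge r n F
    \<and> ex_berge r n F \<le> ex_count k n (complete_hypergraph k r) F + ex_edges k n F"
  using ex_count_le_ex_berge[OF assms(1)] ex_berge_le_ex_count_plus_ex_edges by blast

end
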